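(* The distribution of $G_1+G_2$ with respect to the vacuum state (equivalently, the monotone convolution $\nu\rhd\nu$ of the standard semicircle law $\nu$ with itself) is absolutely continuous with density $$\rho(x)=\begin{cases}\frac{1}{4\pi}\Big(\sqrt{\sqrt{100-16x^2}-x^2+10}-\sqrt{4-x^2}\Big)&\text{if }|x|\le 2,\\[2pt] \frac{1}{4\pi}\sqrt{-2x^2-2|x|\sqrt{x^2-4}+20}&\text{if }2\le|x|\le\frac52,\\[2pt] 0&\text{if }|x|\ge\frac52.\end{cases}$$
   Context: The setting: weakly monotone Fock space $\mathfrak F_{WM}(\mathcal H)$ over a separable Hilbert space with orthonormal basis $\{e_i\}_{i\ge1}$, vacuum $\Omega$, spanned by $\Omega$ and tensors $e_{i_k}\otimes\cdots\otimes e_{i_1}$ with $i_k\ge\cdots\ge i_1$; weakly monotone annihilation/creation operators defined by $A_i\Omega=0$, $A_i(e_{i_k}\otimes\cdots\otimes e_{i_1})=\delta_{i,i_k}e_{i_{k-1}}\otimes\cdots\otimes e_{i_1}$, $A_i^\dagger\Omega=e_i$, $A_i^\dagger(e_{i_k}\otimes\cdots\otimes e_{i_1})=e_i\otimes e_{i_k}\otimes\cdots\otimes e_{i_1}$ if $i\ge i_k$ and $0$ otherwise; position operators $G_i=A_i+A_i^\dagger$; vacuum state $\omega_\Omega(X)=\langle\Omega,X\Omega\rangle$. The distribution of a bounded self-adjoint $X$ is the probability measure with moments $\omega_\Omega(X^n)$. The standard semicircle (Wigner) law is $\nu(dx)=\frac1{2\pi}\sqrt{4-x^2}\mathbf 1_{[-2,2]}dx$.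 For probability measures $\mu,\nu$ on $\mathbb R$ with Cauchy transforms $\mathcal G_\mu(z)=\int\frac{\mu(dx)}{z-x}$ and reciprocal Cauchy transforms $H_\mu=1/\mathcal G_\mu$, the monotone convolution $\mu\rhd\nu$ is the unique probability measure $\rho$ with $H_\rho=H_\mu\circ H_\nu$ on $\mathbb C^+$. *)

theory Defs
  imports "HOL-Probability.Probability"
begin

text \<open>Weakly monotone Fock space over a Hilbert space with orthonormal basis e_1, e_2, ...
  A basis tensor e_{i_k} (x) ... (x) e_{i_1} with i_k >= ... >= i_1 >= 1 is encoded by the list
  [i_k, ..., i_1]; the vacuum is the empty list.  Vectors (finite linear combinations of basis
  tensors) are encoded by their coefficient functions of type nat list => real.  Since the basis
  is orthonormal, the vacuum expectation of X is the coefficient of the empty list in X Omega.\<close>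

definition wm_valid :: "nat list \<Rightarrow> bool" where
  "wm_valid w \<longleftrightarrow> sorted_wrt (\<ge>) w \<and> (\<forall>i\<in>set w. 1 \<le> i)"

type_synonym wm_vec = "nat list \<Rightarrow> real"

definition wm_vacuum :: wm_vec where
  "wm_vacuum = (\<lambda>w. if w = [] then 1 else 0)"

text \<open>Annihilation: A_i Omega = 0, A_i e_{[j] @ u} = delta_{ij} e_u.\<close>
definition wm_ann :: "nat \<Rightarrow> wm_vec \<Rightarrow> wm_vec" where
  "wm_ann i v = (\<lambda>u. if wm_valid u \<and> wm_valid (i # u) then v (i # u) else 0)"

text \<open>Creation: A_i^dagger e_u = e_{i # u} if u = [] or i >= head of u, and 0 otherwise.\<close>
definition wm_cre :: "nat \<Rightarrow> wm_vec \<Rightarrow> wm_vec" where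
  "wm_cre i v = (\<lambda>w. case w of [] \<Rightarrow> 0
                     | j # u \<Rightarrow> if j = i \<and> wm_valid (i # u) then v u else 0)"

definition wm_pos :: "nat \<Rightarrow> wm_vec \<Rightarrow> wm_vec" where
  "wm_pos i v = (\<lambda>w. wm_ann i v w + wm_cre i v w)"

definition wm_vacuum_state :: "(wm_vec \<Rightarrow> wm_vec) \<Rightarrow> real" where
  "wm_vacuum_state X = X wm_vacuum []"

definition G12_moment :: "nat \<Rightarrow> real" where
  "G12_moment n = wm_vacuum_state ((\<lambda>v w. wm_pos 1 v w + wm_pos 2 v w) ^^ n)"

definition is_distribution_with_moments :: "real measure \<Rightarrow> (nat \<Rightarrow> real) \<Rightarrow> bool" where
  "is_distribution_with_moments \<mu> m \<longleftrightarrow>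
     prob_space \<mu> \<and> sets \<mu> = sets borel \<and>
     (\<forall>n. integrable \<mu> (\<lambda>x. x ^ n) \<and> (\<integral>x. x ^ n \<partial>\<mu>) = m n)"

definition rho34 :: "real \<Rightarrow> real" where
  "rho34 x = (if \<bar>x\<bar> \<le> 2 then
                 (sqrt (sqrt (100 - 16 * x\<^sup>2) - x\<^sup>2 + 10) - sqrt (4 - x\<^sup>2)) / (4 * pi)
              else if \<bar>x\<bar> \<le> 5 / 2 then
                 sqrt (- 2 * x\<^sup>2 - 2 * \<bar>x\<bar> * sqrt (x\<^sup>2 - 4) + 20) / (4 * pi)
              else 0)"

end

theory Submission
  imports Defs
begin

text \<open>
  Let \<open>s\<close> be the semicircle density and \<open>U\<^sub>k\<close> the Chebyshev polynomials of the second kind, scaled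
  to \<open>[-2, 2]\<close>.  The orbit of the vacuum under \<open>G\<^sub>1 + G\<^sub>2\<close> lives on the comb of words
  \<open>2\<^sup>j 1\<^sup>a\<close>, and there \<open>U\<^sub>k (G\<^sub>1 + G\<^sub>2) \<Omega>\<close> has the coefficients
  \<open>\<integral> y\<^sup>k\<^sup>-\<^sup>j U\<^sub>a(y) s(y) dy\<close>.  Hence \<open>\<rho>\<close> has the right moments as soon as
  \<open>\<integral> U\<^sub>k(x) \<rho>(x) dx = \<integral> y\<^sup>k s(y) dy\<close> for all \<open>k\<close>.

  The latter identity comes from disintegrating the monotone convolution over its first factor:
  convolving the point mass at \<open>y\<close> with the semicircle law gives
  \<open>s(x) / (1 - x y + y\<^sup>2) dx\<close>, together with an atom of mass \<open>1 - 1 / y\<^sup>2\<close> at \<open>y + 1 / y\<close> if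
  \<open>\<bar>y\<bar> > 1\<close>, and this measure integrates \<open>U\<^sub>k\<close> to \<open>y\<^sup>k\<close>.  Averaging over \<open>s(y) dy\<close>, the
  absolutely continuous parts yield \<open>\<rho>\<close> on \<open>[-2, 2]\<close> (through the Cauchy transform of the
  semicircle law), and the atoms, via \<open>x = y + 1 / y\<close>, yield \<open>\<rho>\<close> on \<open>2 \<le> \<bar>x\<bar> \<le> 5 / 2\<close>.
\<close>

section \<open>Chebyshev polynomials of the second kind\<close>

fun chebU :: "nat \<Rightarrow> real \<Rightarrow> real" where
  "chebU 0 x = 1"
| "chebU (Suc 0) x = x"
| "chebU (Suc (Suc n)) x = x * chebU (Suc n) x - chebU n x"

text \<open>The recursion of \<open>chebU\<close> is the addition formula for the sine. The factor
  \<open>sin t\<close> stays on the left, so that zeros of the sine need no exception.\<close>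

lemma chebU_cos: "chebU n (2 * cos t) * sin t = sin (real (Suc n) * t)"
proof (induction n rule: induct_nat_012)
  case 0 show ?case by simp
next
  case 1 show ?case by (simp add: sin_double)
next
  case (ge2 n)
  have "sin (real (Suc (Suc (Suc n))) * t) + sin (real (Suc n) * t)
      = 2 * cos t * sin (real (Suc (Suc n)) * t)"
    using sin_add[of "real (Suc (Suc n)) * t" t] sin_diff[of "real (Suc (Suc n)) * t" t]
    by (simp add: algebra_simps)
  with ge2 show ?case by (simp add: algebra_simps)
qed

text \<open>The analogue of \<open>chebU_cos\<close> with a real \<open>w\<close> in place of the
  phase; it evaluates \<open>chebU n\<close> at the position \<open>y + 1 / y\<close> of an
  atom.\<close>

lemma chebU_joukowski:
  assumes "w \<noteq> 0"
  shows "(w - 1 / w) * chebU n (w + 1 / w) = w ^ Suc n - 1 / w ^ Suc n"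
proof (induction n rule: induct_nat_012)
  case 0 show ?case by simp
next
  case 1 show ?case using assms by (simp add: field_simps power2_eq_square)
next
  case (ge2 n)
  have "(w - 1 / w) * chebU (Suc (Suc n)) (w + 1 / w)
     = (w + 1 / w) * ((w - 1 / w) * chebU (Suc n) (w + 1 / w)) - (w - 1 / w) * chebU n (w + 1 / w)"
    unfolding chebU.simps by (simp only: right_diff_distrib mult.left_commute)
  also have "\<dots> = (w + 1 / w) * (w ^ Suc (Suc n) - 1 / w ^ Suc (Suc n)) - (w ^ Suc n - 1 / w ^ Suc n)"
    by (simp only: ge2)
  also have "\<dots> = w ^ Suc (Suc (Suc n)) - 1 / w ^ Suc (Suc (Suc n))"
    using assms by (simp add: field_simps)
  finally show ?case .
qed

lemma continuous_on_chebU [continuous_intros]: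
  assumes "continuous_on A f"
  shows "continuous_on A (\<lambda>x. chebU n (f x))"
  using assms by (induction n rule: induct_nat_012) (auto intro!: continuous_intros)

lemma chebU_borel_measurable [measurable]: "chebU n \<in> borel_measurable borel"
  using continuous_on_chebU[OF continuous_on_id, of UNIV n]
  by (intro borel_measurable_continuous_onI) simp

section \<open>Orthogonality of sines and the Poisson kernel\<close>

lemma has_integral_sin_sin:
  "((\<lambda>t. sin (real (Suc m) * t) * sin (real (Suc n) * t)) has_integral (if m = n then pi / 2 else 0)) {0..pi}"
proof -
  \<comment> \<open>An antiderivative of the cosine of integer frequency \<open>j\<close>, with
    frequency 0 apart. The product-to-sum formula needs the frequencies \<open>m - n\<close> and
    \<open>m + n + 2\<close>, and only the first can vanish.\<close>
  define P :: "int \<Rightarrow> real \<Rightarrow> real" where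
    "P j t = (if j = 0 then t else sin (of_int j * t) / of_int j)" for j t
  have D: "(P j has_vector_derivative cos (of_int j * t)) (at t within {0..pi})" for j t
    by (cases "j = 0")
      (auto simp: P_def[abs_def] has_real_derivative_iff_has_vector_derivative[symmetric]
            intro!: derivative_eq_intros)
  have sin0: "sin (of_int j * pi) = 0" for j
    using sin_zero_iff_int2 by auto
  have I: "((\<lambda>t. cos (of_int j * t)) has_integral (if j = 0 then pi else 0)) {0..pi}" for j
    using fundamental_theorem_of_calculus[of 0 pi "P j" "\<lambda>t. cos (of_int j * t)"] D
    by (auto simp: P_def sin0)
  have eq: "sin (real (Suc m) * t) * sin (real (Suc n) * t)
     = (cos (of_int (int m - int n) * t) - cos (of_int (int m + int n + 2) * t)) / 2" for t
    by (simp add: sin_times_sin algebra_simps)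
  show ?thesis
    unfolding eq
    using has_integral_divide[OF has_integral_diff[OF I[of "int m - int n"] I[of "int m + int n + 2"]], of 2]
    by (auto split: if_splits)
qed

text \<open>The generating function of the sines \<open>sin ((m + 1) t)\<close>, truncated with an
  exact remainder, so that no infinite series has to be integrated termwise.\<close>

lemma sin_poisson_partial_sum:
  fixes q :: complex
  shows "(1 - 2 * q * of_real (cos t) + q\<^sup>2) * (\<Sum>m<N. q ^ m * of_real (sin (real (Suc m) * t)))
     = of_real (sin t) - q ^ N * (of_real (sin (real (Suc N) * t)) - q * of_real (sin (real N * t)))"
proof (induction N)
  case 0 show ?case by simp
next
  case (Suc N)
  have "sin (real (Suc (Suc N)) * t) + sin (real N * t) = 2 * cos t * sin (real (Suc N) * t)"
    using sin_add[of "real (Suc N) * t" t] sin_diff[of "real (Suc N) * t" t]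
    by (simp add: algebra_simps)
  hence "complex_of_real (sin (real (Suc (Suc N)) * t)) + of_real (sin (real N * t))
      = 2 * of_real (cos t) * of_real (sin (real (Suc N) * t))"
    by (metis of_real_add of_real_mult of_real_numeral)
  hence *: "complex_of_real (sin (real (Suc (Suc N)) * t))
      = 2 * of_real (cos t) * of_real (sin (real (Suc N) * t)) - of_real (sin (real N * t))"
    by (simp add: algebra_simps)
  show ?case
    unfolding sum.lessThan_Suc distrib_left Suc.IH * 
    by (simp add: algebra_simps power2_eq_square)
qed

text \<open>The denominator factors as \<open>(1 - q * cis t) * (1 - q * cis (- t))\<close>. The
  bound is uniform in \<open>t\<close>, as the remainder estimate requires.\<close>

lemma poisson_denominator_ge:
  fixes q :: complex
  assumes "norm q < 1"
  shows "(1 - norm q)\<^sup>2 \<le> norm (1 - 2 * q * of_real (cos t) + q\<^sup>2)"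
proof -
  have sum: "cis t + cis (- t) = 2 * of_real (cos t)" and prod: "cis t * cis (- t) = 1"
    by (simp_all add: complex_eq_iff cis_mult)
  have "(1 - q * cis t) * (1 - q * cis (- t)) = 1 - q * (cis t + cis (- t)) + q\<^sup>2 * (cis t * cis (- t))"
    by (simp only: power2_eq_square ring_distribs mult_1_left mult_1_right mult_ac) simp
  hence eq: "1 - 2 * q * of_real (cos t) + q\<^sup>2 = (1 - q * cis t) * (1 - q * cis (- t))"
    by (simp only: sum prod) (simp add: mult_ac)
  have "1 - norm q \<le> norm (1 - q * cis s)" for s
    using norm_triangle_ineq2[of 1 "q * cis s"] by (simp add: norm_mult)
  hence "(1 - norm q) * (1 - norm q) \<le> norm (1 - q * cis t) * norm (1 - q * cis (- t))"
    using assms by (intro mult_mono) auto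
  thus ?thesis unfolding eq norm_mult by (simp add: power2_eq_square)
qed

lemma poisson_denominator_nonzero:
  fixes q :: complex
  assumes "norm q < 1"
  shows "1 - 2 * q * of_real (cos t) + q\<^sup>2 \<noteq> 0"
  using poisson_denominator_ge[OF assms, of t] assms by (auto simp: power2_eq_square mult_le_0_iff)

text \<open>Orthogonality extracts the term \<open>m = k\<close> from the truncated series, and the
  remainder tends to 0 uniformly in \<open>t\<close>. A complex \<open>q\<close> is needed for the
  Cauchy transform.\<close>

lemma has_integral_sin_poisson:
  fixes q :: complex
  assumes q: "norm q < 1"
  shows "((\<lambda>t. of_real (sin t * sin (real (Suc k) * t)) / (1 - 2 * q * of_real (cos t) + q\<^sup>2))
           has_integral (of_real pi / 2 * q ^ k)) {0..pi}"
proof -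
  define D where "D t = 1 - 2 * q * of_real (cos t) + q\<^sup>2" for t :: real
  define f where "f t = of_real (sin t * sin (real (Suc k) * t)) / D t" for t
  define R where "R N t = q ^ N * of_real (sin (real (Suc k) * t))
      * (of_real (sin (real (Suc N) * t)) - q * of_real (sin (real N * t))) / D t" for N t
  have D0: "D t \<noteq> 0" for t using poisson_denominator_nonzero[OF q] by (simp add: D_def)
  have cont: "continuous_on {0..pi} D" unfolding D_def by (intro continuous_intros)
  have f_int: "f integrable_on {0..pi}" unfolding f_def
    by (intro integrable_continuous_interval continuous_intros cont) (auto simp: D0)
  have R_int: "R N integrable_on {0..pi}" for N unfolding R_def
    by (intro integrable_continuous_interval continuous_intros cont) (auto simp: D0)
  \<comment> \<open>The factors of the remainder other than \<open>q ^ N\<close> have norm at most 2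
    in the numerator and at least \<open>(1 - norm q)^2\<close> in the denominator.\<close>
  define C where "C = 2 / (1 - norm q)\<^sup>2"
  have R_le: "norm (R N t) \<le> C * norm q ^ N" for N t
  proof -
    have "norm (complex_of_real (sin (real (Suc N) * t)) - q * of_real (sin (real N * t))) \<le> 1 + 1 * 1"
      by (intro order_trans[OF norm_triangle_ineq4] add_mono)
         (use q in \<open>auto simp: norm_mult intro!: mult_le_one\<close>)
    moreover have "norm (complex_of_real (sin (real (Suc k) * t))) \<le> 1"
      using abs_sin_le_one[of "real (Suc k) * t"] by (simp only: norm_of_real)
    ultimately have "norm (complex_of_real (sin (real (Suc k) * t)))
        * norm (complex_of_real (sin (real (Suc N) * t)) - q * of_real (sin (real N * t))) \<le> 1 * 2"
      by (intro mult_mono) auto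
    hence "norm (R N t) \<le> norm q ^ N * 2 / norm (D t)"
      unfolding R_def norm_mult norm_divide norm_power mult.assoc
      by (intro divide_right_mono mult_left_mono) auto
    also have "\<dots> \<le> norm q ^ N * 2 / (1 - norm q)\<^sup>2"
      using poisson_denominator_ge[OF q, of t] q
      by (intro divide_left_mono mult_pos_pos) (auto simp: D_def[symmetric] D0)
    finally show ?thesis by (simp add: C_def mult.commute)
  qed
  have sum_int: "((\<lambda>t. \<Sum>m<N. q ^ m * of_real (sin (real (Suc m) * t) * sin (real (Suc k) * t)))
      has_integral (\<Sum>m<N. q ^ m * of_real (if m = k then pi / 2 else 0))) {0..pi}" for N
    by (intro has_integral_sum has_integral_mult_right has_integral_of_real has_integral_sin_sin) auto
  \<comment> \<open>Once \<open>k < N\<close>, the partial sum contains the term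
    \<open>m = k\<close> and its integral no longer depends on \<open>N\<close>.\<close>
  have "norm (integral {0..pi} f - of_real pi / 2 * q ^ k) \<le> C * pi * norm q ^ N" if "k < N" for N
  proof -
    have eq: "f t = (\<Sum>m<N. q ^ m * of_real (sin (real (Suc m) * t) * sin (real (Suc k) * t))) + R N t" for t
    proof -
      have "of_real (sin t) = D t * (\<Sum>m<N. q ^ m * of_real (sin (real (Suc m) * t)))
          + q ^ N * (of_real (sin (real (Suc N) * t)) - q * of_real (sin (real N * t)))"
        unfolding D_def by (subst sin_poisson_partial_sum) (simp only: diff_add_cancel)
      hence "f t = (\<Sum>m<N. q ^ m * of_real (sin (real (Suc m) * t))) * of_real (sin (real (Suc k) * t)) + R N t"
        unfolding f_def R_def of_real_mult using D0[of t]
        by (simp only:) (simp add: field_simps del: of_nat_Suc)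
      thus ?thesis by (simp add: sum_distrib_right mult.assoc del: of_nat_Suc)
    qed
    have "(f has_integral ((\<Sum>m<N. q ^ m * of_real (if m = k then pi / 2 else 0)) + integral {0..pi} (R N))) {0..pi}"
      unfolding eq[abs_def] by (intro has_integral_add sum_int integrable_integral R_int)
    moreover have "(\<Sum>m<N. q ^ m * complex_of_real (if m = k then pi / 2 else 0)) = of_real pi / 2 * q ^ k"
    proof -
      have "(\<Sum>m<N. q ^ m * complex_of_real (if m = k then pi / 2 else 0))
         = (\<Sum>m<N. if m = k then of_real pi / 2 * q ^ m else 0)"
        by (intro sum.cong) auto
      thus ?thesis using that by simp
    qed
    ultimately have "integral {0..pi} f - of_real pi / 2 * q ^ k = integral {0..pi} (R N)"
      by (simp add: integral_unique)
    also have "norm \<dots> \<le> integral {0..pi} (\<lambda>t. C * norm q ^ N)"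
      by (intro integral_norm_bound_integral R_int R_le) auto
    finally show ?thesis by (simp add: mult_ac)
  qed
  hence ev: "\<forall>\<^sub>F N in sequentially.
      norm (integral {0..pi} f - of_real pi / 2 * q ^ k) \<le> C * pi * norm q ^ N"
    by (intro eventually_sequentiallyI[of "Suc k"]) auto
  have "(\<lambda>N. C * pi * norm q ^ N) \<longlonglongrightarrow> C * pi * 0"
    using q by (intro tendsto_intros LIMSEQ_power_zero) auto
  from tendsto_lowerbound[OF this ev]
  have "norm (integral {0..pi} f - of_real pi / 2 * q ^ k) \<le> 0" by simp
  hence "integral {0..pi} f = of_real pi / 2 * q ^ k" by simp
  hence "(f has_integral (of_real pi / 2 * q ^ k)) {0..pi}"
    using integrable_integral[OF f_int] by (simp only:)
  thus ?thesis by (simp only: f_def[abs_def] D_def[abs_def])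
qed

section \<open>The semicircle law\<close>

definition semicircle :: "real \<Rightarrow> real" where
  "semicircle y = indicator {-2..2} y * sqrt (4 - y\<^sup>2) / (2 * pi)"

lemma semicircle_nonneg: "0 \<le> semicircle y"
proof -
  have "y\<^sup>2 \<le> 4" if "\<bar>y\<bar> \<le> 2" using that abs_le_square_iff[of y 2] by simp
  thus ?thesis by (auto simp: semicircle_def indicator_def abs_le_iff)
qed

lemma semicircle_eq_0:
  assumes "\<bar>y\<bar> \<ge> 2"
  shows "semicircle y = 0"
proof -
  have "y = 2 \<or> y = - 2" if "y \<in> {-2..2}" using that assms by auto
  thus ?thesis by (auto simp: semicircle_def indicator_def)
qed

lemma semicircle_eq: "\<bar>y\<bar> \<le> 2 \<Longrightarrow> semicircle y = sqrt (4 - y\<^sup>2) / (2 * pi)"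
  by (auto simp: semicircle_def indicator_def abs_if split: if_splits)

lemma semicircle_borel_measurable [measurable]: "semicircle \<in> borel_measurable borel"
  unfolding semicircle_def by measurable

text \<open>Substituting \<open>y = 2 * cos t\<close> turns the semicircle law into the weight
  \<open>2 / pi * (sin t)^2\<close> on \<open>{0..pi}\<close>. The codomain is general because both
  real and complex integrands occur.\<close>

lemma semicircle_integral:
  fixes F :: "real \<Rightarrow> 'a::euclidean_space"
  assumes F: "continuous_on {-2..2} F"
  shows integrable_semicircle: "integrable lborel (\<lambda>y. semicircle y *\<^sub>R F y)"
    and has_integral_semicircle: "((\<lambda>t. (2 / pi * (sin t)\<^sup>2) *\<^sub>R F (2 * cos t)) has_integral
          (LINT y|lborel. semicircle y *\<^sub>R F y)) {0..pi}"
proof -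
  define h where "h y = (sqrt (4 - y\<^sup>2) / (2 * pi)) *\<^sub>R F y" for y
  have h: "continuous_on {-2..2} h"
    unfolding h_def by (intro continuous_intros F) auto
  have eq: "semicircle y *\<^sub>R F y = indicator {-2..2} y *\<^sub>R h y" for y
    by (simp add: semicircle_def h_def)
  have si: "set_integrable lborel {-2..2} h"
    by (rule borel_integrable_atLeastAtMost'[OF h])
  show "integrable lborel (\<lambda>y. semicircle y *\<^sub>R F y)"
    using si by (simp add: set_integrable_def eq)
  have int: "(LINT y|lborel. semicircle y *\<^sub>R F y) = integral {-2..2} h"
    using set_borel_integral_eq_integral(2)[OF si] by (simp add: set_lebesgue_integral_def eq)
  \<comment> \<open>The cosine reverses orientation: the first of the two integrals runs over an
    empty interval, and the sign is corrected afterwards.\<close>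
  have "((\<lambda>t. (- 2 * sin t) *\<^sub>R h (2 * cos t)) has_integral
      (integral {2 * cos 0..2 * cos pi} h - integral {2 * cos pi..2 * cos 0} h)) {0..pi}"
  proof (rule has_integral_substitution_general[of "{}" 0 pi "\<lambda>t. 2 * cos t" "-2" 2 h])
    show "(\<lambda>t. 2 * cos t) ` {0..pi} \<subseteq> {-2..2}"
    proof (intro image_subsetI)
      fix t :: real
      show "2 * cos t \<in> {-2..2}" using cos_ge_minus_one[of t] cos_le_one[of t] by simp
    qed
    show "continuous_on {0..pi} (\<lambda>t. 2 * cos t)" by (intro continuous_intros)
    show "((\<lambda>t. 2 * cos t) has_field_derivative - 2 * sin t) (at t within {0..pi})" for t
      by (auto intro!: derivative_eq_intros)
  qed (use h in auto)
  from has_integral_neg[OF this]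
  have neg: "((\<lambda>t. - ((- 2 * sin t) *\<^sub>R h (2 * cos t))) has_integral integral {-2..2} h) {0..pi}"
    by simp
  have eq': "- ((- 2 * sin t) *\<^sub>R h (2 * cos t)) = (2 / pi * (sin t)\<^sup>2) *\<^sub>R F (2 * cos t)"
    if "t \<in> {0..pi}" for t
  proof -
    have "sqrt (4 - (2 * cos t)\<^sup>2) = 2 * sin t"
      using that by (intro real_sqrt_unique) (auto simp: power_mult_distrib cos_squared_eq sin_ge_zero)
    thus ?thesis by (simp add: h_def power2_eq_square)
  qed
  show "((\<lambda>t. (2 / pi * (sin t)\<^sup>2) *\<^sub>R F (2 * cos t)) has_integral
          (LINT y|lborel. semicircle y *\<^sub>R F y)) {0..pi}"
    unfolding int by (rule has_integral_eq[OF eq' neg])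
qed

lemma semicircle_chebU: "(LINT y|lborel. semicircle y * chebU k y) = (if k = 0 then 1 else 0)"
proof -
  have A: "((\<lambda>t. (2 / pi * (sin t)\<^sup>2) *\<^sub>R chebU k (2 * cos t)) has_integral
      (LINT y|lborel. semicircle y *\<^sub>R chebU k y)) {0..pi}"
    by (intro has_integral_semicircle continuous_intros)
  have eq: "(2 / pi * (sin t)\<^sup>2) *\<^sub>R chebU k (2 * cos t)
      = 2 / pi * (sin (real (Suc k) * t) * sin (real (Suc 0) * t))" for t
    unfolding chebU_cos[symmetric] by (simp add: power2_eq_square)
  have B: "((\<lambda>t. 2 / pi * (sin (real (Suc k) * t) * sin (real (Suc 0) * t))) has_integral
      2 / pi * (if k = 0 then pi / 2 else 0)) {0..pi}"
    by (intro has_integral_mult_right has_integral_sin_sin)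
  have "(LINT y|lborel. semicircle y *\<^sub>R chebU k y) = 2 / pi * (if k = 0 then pi / 2 else 0)"
    using has_integral_unique[OF A[unfolded eq] B] .
  thus ?thesis by simp
qed

section \<open>The kernel \<open>1 / (1 - x y + y^2)\<close> and the Cauchy transform\<close>

lemma kesten_denominator_nonneg:
  fixes x y :: real
  assumes "\<bar>x\<bar> \<le> 2"
  shows "0 \<le> 1 - x * y + y\<^sup>2"
proof -
  have "0 \<le> (1 - \<bar>y\<bar>)\<^sup>2" by simp
  moreover have "\<bar>x * y\<bar> \<le> 2 * \<bar>y\<bar>" using assms by (simp add: abs_mult mult_right_mono)
  ultimately show ?thesis by (simp add: power2_eq_square algebra_simps)
qed

lemma kesten_denominator_pos:
  fixes x y :: real
  assumes "\<bar>x\<bar> \<le> 2" "\<bar>y\<bar> \<noteq> 1"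
  shows "0 < 1 - x * y + y\<^sup>2"
proof -
  have "0 < (1 - \<bar>y\<bar>)\<^sup>2" using assms by simp
  moreover have "\<bar>x * y\<bar> \<le> 2 * \<bar>y\<bar>" using assms by (simp add: abs_mult mult_right_mono)
  ultimately show ?thesis by (simp add: power2_eq_square algebra_simps)
qed

text \<open>For \<open>abs y < 1\<close> this is the Poisson integral at \<open>q = y\<close>; for
  \<open>abs y > 1\<close> the denominator is \<open>y^2\<close> times the one at
  \<open>1 / y\<close>. At \<open>abs y = 1\<close> it vanishes at an endpoint of the
  support.\<close>

lemma semicircle_kesten:
  assumes "\<bar>y\<bar> \<noteq> 1"
  shows integrable_semicircle_kesten: "integrable lborel (\<lambda>x. semicircle x * (chebU k x / (1 - x * y + y\<^sup>2)))"
    and LINT_semicircle_kesten: "(LINT x|lborel. semicircle x * (chebU k x / (1 - x * y + y\<^sup>2)))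
          = (if \<bar>y\<bar> < 1 then y ^ k else 1 / y ^ (k + 2))"
proof -
  have cont: "continuous_on {-2..2} (\<lambda>x. chebU k x / (1 - x * y + y\<^sup>2))" if "\<bar>y\<bar> \<noteq> 1" for y
  proof (intro continuous_intros ballI)
    fix x :: real assume "x \<in> {-2..2}"
    hence "\<bar>x\<bar> \<le> 2" by auto
    from kesten_denominator_pos[OF this that] show "1 - x * y + y\<^sup>2 \<noteq> 0" by simp
  qed
  show "integrable lborel (\<lambda>x. semicircle x * (chebU k x / (1 - x * y + y\<^sup>2)))"
    using integrable_semicircle[OF cont[OF assms]] by simp
  have small: "(LINT x|lborel. semicircle x * (chebU k x / (1 - x * y + y\<^sup>2))) = y ^ k" if y: "\<bar>y\<bar> < 1" for y
  proof -
    \<comment> \<open>At a real parameter the complex kernel is real, so taking real parts loses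
      nothing.\<close>
    have "((\<lambda>t. Re (of_real (sin t * sin (real (Suc k) * t)) / (1 - 2 * of_real y * of_real (cos t) + (of_real y)\<^sup>2)))
        has_integral Re (of_real pi / 2 * of_real y ^ k)) {0..pi}"
      by (intro has_integral_Re has_integral_sin_poisson) (use y in simp)
    moreover have "Re (of_real (sin t * sin (real (Suc k) * t)) / (1 - 2 * of_real y * of_real (cos t) + (of_real y)\<^sup>2))
        = sin t * sin (real (Suc k) * t) / (1 - 2 * y * cos t + y\<^sup>2)" for t
    proof -
      have "of_real (sin t * sin (real (Suc k) * t)) / (1 - 2 * of_real y * of_real (cos t) + (of_real y)\<^sup>2)
         = complex_of_real (sin t * sin (real (Suc k) * t) / (1 - 2 * y * cos t + y\<^sup>2))"
        by simp
      thus ?thesis by (simp only: Re_complex_of_real)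
    qed
    moreover have "Re (of_real pi / 2 * of_real y ^ k) = pi / 2 * y ^ k"
    proof -
      have "of_real pi / 2 * of_real y ^ k = complex_of_real (pi / 2 * y ^ k)" by simp
      thus ?thesis by (simp only: Re_complex_of_real)
    qed
    ultimately have "((\<lambda>t. sin t * sin (real (Suc k) * t) / (1 - 2 * y * cos t + y\<^sup>2))
        has_integral (pi / 2 * y ^ k)) {0..pi}" by (simp only:)
    hence A: "((\<lambda>t. 2 / pi * (sin t * sin (real (Suc k) * t) / (1 - 2 * y * cos t + y\<^sup>2)))
        has_integral (2 / pi * (pi / 2 * y ^ k))) {0..pi}"
      by (rule has_integral_mult_right)
    have B: "((\<lambda>t. (2 / pi * (sin t)\<^sup>2) *\<^sub>R (chebU k (2 * cos t) / (1 - (2 * cos t) * y + y\<^sup>2))) has_integral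
          (LINT x|lborel. semicircle x *\<^sub>R (chebU k x / (1 - x * y + y\<^sup>2)))) {0..pi}"
      by (rule has_integral_semicircle) (use cont y in auto)
    have eq: "(2 / pi * (sin t)\<^sup>2) *\<^sub>R (chebU k (2 * cos t) / (1 - (2 * cos t) * y + y\<^sup>2))
      = 2 / pi * (sin t * sin (real (Suc k) * t) / (1 - 2 * y * cos t + y\<^sup>2))" for t
      unfolding chebU_cos[symmetric] by (simp add: power2_eq_square mult_ac)
    from has_integral_unique[OF B[unfolded eq] A]
    show ?thesis by simp
  qed
  show "(LINT x|lborel. semicircle x * (chebU k x / (1 - x * y + y\<^sup>2)))
          = (if \<bar>y\<bar> < 1 then y ^ k else 1 / y ^ (k + 2))"
  proof (cases "\<bar>y\<bar> < 1")
    case True thus ?thesis unfolding small[OF True] by simp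
  next
    case False
    hence y: "\<bar>y\<bar> > 1" using assms by simp
    have "semicircle x * (chebU k x / (1 - x * y + y\<^sup>2))
        = 1 / y\<^sup>2 * (semicircle x * (chebU k x / (1 - x * (1 / y) + (1 / y)\<^sup>2)))" for x
    proof -
      have "1 - x * y + y\<^sup>2 = y\<^sup>2 * (1 - x * (1 / y) + (1 / y)\<^sup>2)"
        using y by (auto simp: field_simps power2_eq_square)
      thus ?thesis by simp
    qed
    hence "(LINT x|lborel. semicircle x * (chebU k x / (1 - x * y + y\<^sup>2)))
        = 1 / y\<^sup>2 * (LINT x|lborel. semicircle x * (chebU k x / (1 - x * (1 / y) + (1 / y)\<^sup>2)))"
      by (simp only: integral_mult_right_zero)
    also have "\<dots> = 1 / y\<^sup>2 * (1 / y) ^ k" using y by (subst small) auto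
    finally show ?thesis using False by (simp add: power_one_over power_add power2_eq_square mult_ac)
  qed
qed

text \<open>Under \<open>y = 2 * cos t\<close> the difference \<open>q + 1 / q - y\<close> is the
  Poisson denominator divided by \<open>q\<close>. Using \<open>q\<close> as the coordinate avoids
  choosing a branch of the square root.\<close>

lemma semicircle_cauchy_transform:
  fixes q :: complex
  assumes q: "norm q < 1" "q \<noteq> 0"
  shows integrable_semicircle_cauchy: "integrable lborel (\<lambda>y. semicircle y *\<^sub>R (1 / (q + 1 / q - of_real y)))"
    and LINT_semicircle_cauchy: "(LINT y|lborel. semicircle y *\<^sub>R (1 / (q + 1 / q - of_real y))) = q"
proof -
  have den: "q + 1 / q - of_real (2 * cos t) = (1 - 2 * q * of_real (cos t) + q\<^sup>2) / q" for t
    using q by (simp add: field_simps power2_eq_square)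
  have cont: "continuous_on {-2..2} (\<lambda>y. 1 / (q + 1 / q - complex_of_real y))"
  proof (intro continuous_intros ballI)
    fix y :: real assume "y \<in> {-2..2}"
    hence "y = 2 * cos (arccos (y / 2))" by simp
    thus "q + 1 / q - of_real y \<noteq> 0"
      using den[of "arccos (y / 2)"] poisson_denominator_nonzero[OF q(1)] q(2)
      by (metis divide_eq_0_iff)
  qed
  show "integrable lborel (\<lambda>y. semicircle y *\<^sub>R (1 / (q + 1 / q - of_real y)))"
    by (rule integrable_semicircle[OF cont])
  have A: "((\<lambda>t. (2 / pi * (sin t)\<^sup>2) *\<^sub>R (1 / (q + 1 / q - complex_of_real (2 * cos t)))) has_integral
          (LINT y|lborel. semicircle y *\<^sub>R (1 / (q + 1 / q - of_real y)))) {0..pi}"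
    by (rule has_integral_semicircle[OF cont])
  have B: "((\<lambda>t. 2 / of_real pi * q * (of_real (sin t * sin (real (Suc 0) * t)) / (1 - 2 * q * of_real (cos t) + q\<^sup>2)))
      has_integral 2 / of_real pi * q * (of_real pi / 2 * q ^ 0)) {0..pi}"
    by (intro has_integral_mult_right has_integral_sin_poisson q)
  have eq: "(2 / pi * (sin t)\<^sup>2) *\<^sub>R (1 / (q + 1 / q - complex_of_real (2 * cos t)))
     = 2 / of_real pi * q * (of_real (sin t * sin (real (Suc 0) * t)) / (1 - 2 * q * of_real (cos t) + q\<^sup>2))" for t
    unfolding den by (simp add: scaleR_conv_of_real power2_eq_square)
  from has_integral_unique[OF A[unfolded eq] B]
  show "(LINT y|lborel. semicircle y *\<^sub>R (1 / (q + 1 / q - of_real y))) = q" by simp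
qed

section \<open>The comb of words in two letters\<close>

text \<open>The coefficient of \<open>chebU a\<close> when \<open>y ^ k\<close> is expanded in the
  polynomials orthonormal for the semicircle law.\<close>

definition semicircle_moment :: "nat \<Rightarrow> nat \<Rightarrow> real" where
  "semicircle_moment k a = (LINT y|lborel. semicircle y * (y ^ k * chebU a y))"

lemma integrable_semicircle_moment: "integrable lborel (\<lambda>y. semicircle y * (y ^ k * chebU a y))"
  using integrable_semicircle[of "\<lambda>y. y ^ k * chebU a y"] by (simp add: continuous_intros)

lemma semicircle_moment_0: "semicircle_moment 0 a = (if a = 0 then 1 else 0)"
  using semicircle_chebU[of a] by (simp add: semicircle_moment_def)

lemma semicircle_moment_Suc_0: "semicircle_moment (Suc k) 0 = semicircle_moment k (Suc 0)"
  by (simp add: semicircle_moment_def mult_ac)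

lemma semicircle_moment_Suc_Suc: "semicircle_moment (Suc k) (Suc a) = semicircle_moment k (Suc (Suc a)) + semicircle_moment k a"
  unfolding semicircle_moment_def
  by (subst Bochner_Integration.integral_add[symmetric, OF integrable_semicircle_moment integrable_semicircle_moment])
     (simp add: algebra_simps)

text \<open>The recursion again, in the form in which \<open>count_list\<close> leaves the letter
  counts.\<close>

lemma semicircle_moment_Suc_Suc':
  "semicircle_moment (Suc k) (a + 1) = semicircle_moment k (a + 1 + 1) + semicircle_moment k a"
  "semicircle_moment (Suc k) 1 = semicircle_moment k (1 + 1) + semicircle_moment k 0"
  by (simp_all add: semicircle_moment_Suc_Suc eval_nat_numeral)

text \<open>The guard \<open>count_list w 2 \<le> k\<close> matters: natural subtraction would
  otherwise truncate to 0 and leave nonzero entries at words with too many letters 2.\<close>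

definition comb_vec :: "nat \<Rightarrow> wm_vec" where
  "comb_vec k w = (if wm_valid w \<and> set w \<subseteq> {1, 2} \<and> count_list w 2 \<le> k
     then semicircle_moment (k - count_list w 2) (count_list w 1) else 0)"

definition G12 :: "wm_vec \<Rightarrow> wm_vec" where
  "G12 v w = wm_pos 1 v w + wm_pos 2 v w"

lemma wm_valid_Cons: "wm_valid (i # w) \<longleftrightarrow> 1 \<le> i \<and> (\<forall>j\<in>set w. j \<le> i) \<and> wm_valid w"
  by (auto simp: wm_valid_def)


lemma wm_valid_Nil: "wm_valid []"
  by (simp add: wm_valid_def)

lemma comb_vec_0: "comb_vec 0 = wm_vacuum"
proof
  fix w show "comb_vec 0 w = wm_vacuum w"
  proof (cases w)
    case Nil thus ?thesis by (simp add: comb_vec_def wm_vacuum_def wm_valid_Nil semicircle_moment_0)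
  next
    case (Cons i u)
    show ?thesis
    proof (cases "set w \<subseteq> {1, 2} \<and> count_list w 2 = 0")
      case True
      hence "count_list w 1 \<noteq> 0" using Cons by (auto simp: count_list_0_iff)
      thus ?thesis using Cons by (simp add: comb_vec_def wm_vacuum_def semicircle_moment_0)
    next
      case False thus ?thesis using Cons by (auto simp: comb_vec_def wm_vacuum_def)
    qed
  qed
qed

text \<open>The head of a valid word is its largest letter, so a valid word with a letter above 2
  has such a head. Neither creating nor annihilating a 1 or 2 can then contribute, whatever
  \<open>v\<close> is.\<close>

lemma G12_eq_0:
  assumes "\<not> (wm_valid w \<and> set w \<subseteq> {1, 2})"
  shows "G12 v w = 0"
proof (cases w)
  case Nil thus ?thesis using assms by (simp add: wm_valid_Nil)
next
  case (Cons i u)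
  have "\<not> wm_valid w \<or> i > 2"
  proof (rule ccontr)
    assume "\<not> ?thesis"
    hence w: "wm_valid w" "i \<le> 2" by auto
    have "set w \<subseteq> {1, 2}"
    proof
      fix j assume j: "j \<in> set w"
      have "1 \<le> j" using w(1) j by (simp add: wm_valid_def)
      moreover have "j \<le> i" using w(1) j unfolding Cons wm_valid_Cons by auto
      ultimately have "j = 1 \<or> j = 2" using w(2) by arith
      thus "j \<in> {1, 2}" by simp
    qed
    thus False using assms w by simp
  qed
  thus ?thesis
    using Cons by (auto simp: G12_def wm_pos_def wm_ann_def wm_cre_def wm_valid_Cons)
qed

lemma G12_Nil: "G12 v [] = v [1] + v [2]"
  by (simp add: G12_def wm_pos_def wm_ann_def wm_cre_def wm_valid_def)

text \<open>A word of letters 1 lies on the backbone of the comb: it has two neighbours there and a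
  third at the start of a tooth.\<close>

lemma G12_Cons_1:
  assumes "wm_valid (1 # u)"
  shows "G12 v (1 # u) = v (1 # 1 # u) + v u + v (2 # 1 # u)"
  using assms by (auto simp: G12_def wm_pos_def wm_ann_def wm_cre_def wm_valid_Cons)

text \<open>Inside a tooth only two neighbours remain, because a 1 may not be put in front of a
  2.\<close>

lemma G12_Cons_2:
  assumes "wm_valid (2 # u)"
  shows "G12 v (2 # u) = v (2 # 2 # u) + v u"
  using assms by (auto simp: G12_def wm_pos_def wm_ann_def wm_cre_def wm_valid_Cons)

lemma wm_letter_cases:
  assumes "wm_valid w" "set w \<subseteq> {1, 2}"
  obtains "w = []" | u where "w = 1 # u" "set u \<subseteq> {1}" "count_list u 2 = 0" "wm_valid u"
  | u where "w = 2 # u" "set u \<subseteq> {1, 2}" "wm_valid u"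
proof (cases w)
  case (Cons i u)
  hence i: "i = 1 \<or> i = 2" using assms(2) by auto
  have u: "wm_valid u" "set u \<subseteq> {1, 2}" using assms Cons by (auto simp: wm_valid_Cons)
  show ?thesis
  proof (cases "i = 1")
    case True
    have "set u \<subseteq> {1}"
    proof
      fix j assume j: "j \<in> set u"
      have "j \<le> 1" using assms(1) j True unfolding Cons wm_valid_Cons by blast
      moreover have "1 \<le> j" using u(1) j by (simp add: wm_valid_def)
      ultimately show "j \<in> {1}" by simp
    qed
    moreover from this have "count_list u 2 = 0" by (auto simp: count_list_0_iff)
    ultimately show ?thesis using that(2) True Cons u by blast
  next
    case False thus ?thesis using that(3) i Cons u by blast
  qed
qed (rule that(1))

lemma G12_comb_vec_0: "G12 (comb_vec 0) w = comb_vec (Suc 0) w"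
proof (cases "wm_valid w \<and> set w \<subseteq> {1, 2}")
  case False
  hence "comb_vec (Suc 0) w = 0" unfolding comb_vec_def by auto
  thus ?thesis using G12_eq_0[OF False] by simp
next
  case True
  hence "wm_valid w" "set w \<subseteq> {1, 2}" by auto
  thus ?thesis
  proof (cases rule: wm_letter_cases)
    case 1
    thus ?thesis
      by (simp add: G12_Nil comb_vec_def wm_valid_def semicircle_moment_0 semicircle_moment_Suc_0)
  next
    case (2 u)
    with True show ?thesis
      by (auto simp: G12_Cons_1 comb_vec_def wm_valid_Cons semicircle_moment_0 semicircle_moment_Suc_Suc'
            simp del: One_nat_def)
  next
    case (3 u)
    with True show ?thesis
      by (auto simp: G12_Cons_2 comb_vec_def wm_valid_Cons semicircle_moment_0)
  qed
qed

text \<open>The Chebyshev recursion for vectors. On the backbone the two neighbours combine by the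
  recursion of \<open>semicircle_moment\<close>, and the tooth supplies the entry of
  \<open>comb_vec k\<close>; inside a tooth both sides agree after shifting the number of letters
  2.\<close>

lemma G12_comb_vec_Suc: "G12 (comb_vec (Suc k)) w = comb_vec (Suc (Suc k)) w + comb_vec k w"
proof (cases "wm_valid w \<and> set w \<subseteq> {1, 2}")
  case False
  hence "comb_vec (Suc (Suc k)) w = 0" "comb_vec k w = 0" unfolding comb_vec_def by auto
  thus ?thesis using G12_eq_0[OF False] by simp
next
  case True
  hence "wm_valid w" "set w \<subseteq> {1, 2}" by auto
  thus ?thesis
  proof (cases rule: wm_letter_cases)
    case 1
    thus ?thesis
      by (simp add: G12_Nil comb_vec_def wm_valid_def semicircle_moment_Suc_0)
  next
    case (2 u)
    with True show ?thesis
      by (auto simp: G12_Cons_1 comb_vec_def wm_valid_Cons semicircle_moment_Suc_Suc'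
            simp del: One_nat_def)
  next
    case (3 u)
    with True show ?thesis
      by (auto simp: G12_Cons_2 comb_vec_def wm_valid_Cons semicircle_moment_0 Suc_diff_le)
  qed
qed

lemma G12_add: "G12 (\<lambda>w. u w + v w) = (\<lambda>w. G12 u w + G12 v w)"
  by (auto simp: fun_eq_iff G12_def wm_pos_def wm_ann_def wm_cre_def split: list.splits)

lemma G12_funpow_add: "(G12 ^^ n) (\<lambda>w. u w + v w) = (\<lambda>w. (G12 ^^ n) u w + (G12 ^^ n) v w)"
  by (induction n) (simp_all add: G12_add)

lemma comb_vec_Nil: "comb_vec k [] = semicircle_moment k 0"
  by (simp add: comb_vec_def wm_valid_Nil)

text \<open>Multiplication by \<open>x\<close> acts on the polynomials \<open>chebU k\<close>
  exactly as \<open>G12\<close> acts on the vectors \<open>comb_vec k\<close>. The induction on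
  \<open>n\<close> needs all \<open>k\<close> at once, since each step changes the index.\<close>

lemma moments_from_chebU:
  assumes rho: "\<And>k n. integrable lborel (\<lambda>x. r x * (x ^ n * chebU k x))"
    and U: "\<And>k. (LINT x|lborel. r x * chebU k x) = semicircle_moment k 0"
  shows "(LINT x|lborel. r x * (x ^ n * chebU k x)) = (G12 ^^ n) (comb_vec k) []"
proof (induction n arbitrary: k)
  case 0 show ?case by (simp add: U comb_vec_Nil)
next
  case (Suc n)
  show ?case
  proof (cases k)
    case 0
    have "G12 (comb_vec 0) = comb_vec (Suc 0)" by (rule ext) (rule G12_comb_vec_0)
    thus ?thesis using Suc[of "Suc 0"] 0 by (simp add: funpow_Suc_right mult_ac del: funpow.simps)
  next
    case k: (Suc m)
    have "(LINT x|lborel. r x * (x ^ Suc n * chebU k x))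
        = (LINT x|lborel. r x * (x ^ n * chebU (Suc (Suc m)) x) + r x * (x ^ n * chebU m x))"
      by (simp add: k algebra_simps)
    also have "\<dots> = (G12 ^^ n) (comb_vec (Suc (Suc m))) [] + (G12 ^^ n) (comb_vec m) []"
      by (subst Bochner_Integration.integral_add[OF rho rho]) (simp only: Suc)
    also have "\<dots> = (G12 ^^ n) (G12 (comb_vec k)) []"
    proof -
      have "G12 (comb_vec k) = (\<lambda>w. comb_vec (Suc (Suc m)) w + comb_vec m w)"
        unfolding k by (rule ext) (rule G12_comb_vec_Suc)
      thus ?thesis by (simp only: G12_funpow_add)
    qed
    finally show ?thesis by (simp only: funpow_Suc_right o_apply)
  qed
qed

section \<open>The density\<close>

lemma rho34_inner_sqrt_ge:
  assumes "\<bar>x\<bar> \<le> 2"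
  shows "4 - x\<^sup>2 \<le> sqrt (100 - 16 * x\<^sup>2) - x\<^sup>2 + 10" "0 \<le> 4 - x\<^sup>2"
proof -
  show x: "0 \<le> 4 - x\<^sup>2" using assms abs_le_square_iff[of x 2] by simp
  hence "0 \<le> 100 - 16 * x\<^sup>2" by simp
  hence "0 \<le> sqrt (100 - 16 * x\<^sup>2)" by simp
  thus "4 - x\<^sup>2 \<le> sqrt (100 - 16 * x\<^sup>2) - x\<^sup>2 + 10" by simp
qed

text \<open>At \<open>abs x = 2\<close> the definition takes the inner branch, but both formulas
  give \<open>sqrt 12 / (4 * pi)\<close> there.\<close>

lemma rho34_outer_eq:
  assumes "2 \<le> \<bar>x\<bar>" "\<bar>x\<bar> \<le> 5 / 2"
  shows "rho34 x = sqrt (- 2 * x\<^sup>2 - 2 * \<bar>x\<bar> * sqrt (x\<^sup>2 - 4) + 20) / (4 * pi)"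
proof (cases "\<bar>x\<bar> = 2")
  case True
  have "x\<^sup>2 = \<bar>x\<bar>\<^sup>2" by simp
  hence x: "x\<^sup>2 = 4" by (simp only: True) simp
  have "sqrt (36 :: real) = 6" by (rule real_sqrt_unique) auto
  thus ?thesis by (simp add: rho34_def True x)
next
  case False thus ?thesis using assms by (simp add: rho34_def)
qed

lemma rho34_outer_radicand_bounds:
  fixes x :: real
  assumes "2 \<le> \<bar>x\<bar>" "\<bar>x\<bar> \<le> 5 / 2"
  shows "0 \<le> - 2 * x\<^sup>2 - 2 * \<bar>x\<bar> * sqrt (x\<^sup>2 - 4) + 20"
    and "- 2 * x\<^sup>2 - 2 * \<bar>x\<bar> * sqrt (x\<^sup>2 - 4) + 20 \<le> 20"
proof -
  have x: "4 \<le> x\<^sup>2" "x\<^sup>2 \<le> 25 / 4"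
    using power_mono[OF assms(1), of 2] power_mono[OF assms(2), of 2] by (auto simp: power2_eq_square)
  \<comment> \<open>The value 3/2 is attained at \<open>abs x = 5 / 2\<close>, where the radicand is
    exactly 0.\<close>
  have "sqrt (x\<^sup>2 - 4) \<le> 3 / 2" using x by (intro real_le_lsqrt) (auto simp: power2_eq_square)
  hence "\<bar>x\<bar> * sqrt (x\<^sup>2 - 4) \<le> 5 / 2 * (3 / 2)" using assms x by (intro mult_mono) auto
  thus "0 \<le> - 2 * x\<^sup>2 - 2 * \<bar>x\<bar> * sqrt (x\<^sup>2 - 4) + 20" using x by simp
  have "0 \<le> \<bar>x\<bar> * sqrt (x\<^sup>2 - 4)" using x by simp
  thus "- 2 * x\<^sup>2 - 2 * \<bar>x\<bar> * sqrt (x\<^sup>2 - 4) + 20 \<le> 20" using x by linarith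
qed

lemma rho34_nonneg: "0 \<le> rho34 x"
proof (cases "\<bar>x\<bar> \<le> 2")
  case True
  thus ?thesis using rho34_inner_sqrt_ge[OF True] by (simp add: rho34_def)
next
  case False thus ?thesis using rho34_outer_radicand_bounds(1)[of x] by (simp add: rho34_def)
qed

text \<open>A crude bound that suffices for integrability: both outer radicands are at most
  20.\<close>

lemma rho34_le: "rho34 x \<le> 5"
proof -
  have *: "a / (4 * pi) \<le> 5" if "a \<le> 5" for a :: real
  proof -
    have "5 * 1 \<le> 5 * (4 * pi)" using pi_ge_two by (intro mult_left_mono) auto
    thus ?thesis using that by (simp add: divide_le_eq)
  qed
  have s20: "sqrt a \<le> 5" if "a \<le> 20" for a :: real
    using that by (intro real_le_lsqrt) auto
  show ?thesis
  proof (cases "\<bar>x\<bar> \<le> 2")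
    case True
    have "sqrt (100 - 16 * x\<^sup>2) \<le> 10" by (intro real_le_lsqrt) auto
    hence "sqrt (sqrt (100 - 16 * x\<^sup>2) - x\<^sup>2 + 10) \<le> 5"
      by (intro s20) (use zero_le_power2[of x] in linarith)
    moreover have "0 \<le> sqrt (4 - x\<^sup>2)" using rho34_inner_sqrt_ge[OF True] by simp
    ultimately have "sqrt (sqrt (100 - 16 * x\<^sup>2) - x\<^sup>2 + 10) - sqrt (4 - x\<^sup>2) \<le> 5" by linarith
    from *[OF this] show ?thesis using True by (simp add: rho34_def)
  next
    case False
    thus ?thesis using *[OF s20[OF rho34_outer_radicand_bounds(2)[of x]]] by (simp add: rho34_def)
  qed
qed

lemma rho34_eq_0: "\<bar>x\<bar> > 5 / 2 \<Longrightarrow> rho34 x = 0"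
  by (simp add: rho34_def)

lemma rho34_borel_measurable [measurable]: "rho34 \<in> borel_measurable borel"
  unfolding rho34_def by measurable

lemma integrable_rho34:
  fixes F :: "real \<Rightarrow> real"
  assumes "continuous_on UNIV F"
  shows "integrable lborel (\<lambda>x. rho34 x * F x)"
proof -
  have [measurable]: "F \<in> borel_measurable borel" using assms by (rule borel_measurable_continuous_onI)
  have "compact (F ` {-5/2..5/2})"
    by (intro compact_continuous_image continuous_on_subset[OF assms]) auto
  then obtain B where "\<forall>z\<in>F ` {-5/2..5/2}. norm z \<le> B"
    using compact_imp_bounded bounded_iff by blast
  hence B: "norm (F x) \<le> B" if "x \<in> {-5/2..5/2}" for x using that by blast
  show ?thesis
  proof (rule integrableI_bounded_set[where A = "{-5/2..5/2}" and B = "5 * B"])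
    show "AE x in lborel. x \<in> {-5/2..5/2} \<longrightarrow> norm (rho34 x * F x) \<le> 5 * B"
    proof (intro AE_I2 impI)
      fix x :: real assume "x \<in> {-5/2..5/2}"
      thus "norm (rho34 x * F x) \<le> 5 * B"
        unfolding norm_mult using B[of x] rho34_le[of x] rho34_nonneg[of x]
        by (intro mult_mono) auto
    qed
    show "AE x in lborel. x \<notin> {-5/2..5/2} \<longrightarrow> rho34 x * F x = 0"
      by (intro AE_I2) (auto simp: rho34_eq_0)
  qed auto
qed

section \<open>The outer part of the density: the averaged atoms\<close>

text \<open>With \<open>x = y + 1 / y\<close> the root \<open>sqrt (x^2 - 4)\<close> becomes
  \<open>abs y - 1 / abs y\<close>, and the radicand of the outer branch collapses to
  \<open>4 * (4 - y^2)\<close>.\<close>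

lemma rho34_joukowski:
  assumes "1 \<le> \<bar>y\<bar>" "\<bar>y\<bar> \<le> 2"
  shows "2 \<le> \<bar>y + 1 / y\<bar>" "\<bar>y + 1 / y\<bar> \<le> 5 / 2" "rho34 (y + 1 / y) = semicircle y"
proof -
  define a where "a = \<bar>y\<bar>"
  have a: "1 \<le> a" "a \<le> 2" using assms by (auto simp: a_def)
  have abs: "\<bar>y + 1 / y\<bar> = a + 1 / a" 
  proof (cases "y \<ge> 0")
    case False
    hence "y + 1 / y \<le> 0" by (simp add: add_nonpos_nonpos)
    thus ?thesis using False by (simp add: a_def abs_of_nonpos)
  qed (simp add: a_def)
  have sq: "y\<^sup>2 = a\<^sup>2" "(y + 1 / y)\<^sup>2 = (a + 1 / a)\<^sup>2"
    by (simp add: a_def) (metis abs power2_abs)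
  have "0 \<le> (a - 1)\<^sup>2" by simp
  hence "2 * a \<le> a * a + 1" by (simp add: power2_eq_square algebra_simps)
  thus 1: "2 \<le> \<bar>y + 1 / y\<bar>" unfolding abs using a by (simp add: field_simps)
  \<comment> \<open>This is \<open>a + 1 / a \<le> 2 + 1 / 2\<close> with denominators cleared,
    factored at its roots 1/2 and 2.\<close>
  have "0 \<le> (2 * a - 1) * (2 - a)" using a by (intro mult_nonneg_nonneg) auto
  hence "a * a + 1 \<le> 5 / 2 * a" by (simp add: algebra_simps)
  thus 2: "\<bar>y + 1 / y\<bar> \<le> 5 / 2" unfolding abs using a by (simp add: field_simps)
  have s: "sqrt ((a + 1 / a)\<^sup>2 - 4) = a - 1 / a"
  proof (rule real_sqrt_unique)
    show "(a - 1 / a)\<^sup>2 = (a + 1 / a)\<^sup>2 - 4" using a by (simp add: power2_eq_square field_simps)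
    show "0 \<le> a - 1 / a" using a mult_mono[of 1 a 1 a] by (simp add: field_simps)
  qed
  have "- 2 * (a + 1 / a)\<^sup>2 - 2 * (a + 1 / a) * (a - 1 / a) + 20 = 4 * (4 - a\<^sup>2)"
    using a by (simp add: power2_eq_square field_simps)
  hence "rho34 (y + 1 / y) = sqrt (4 * (4 - a\<^sup>2)) / (4 * pi)"
    unfolding rho34_outer_eq[OF 1 2] abs sq s by simp
  also have "\<dots> = semicircle y"
    unfolding real_sqrt_mult semicircle_eq[OF assms(2)] sq(1) by simp
  finally show "rho34 (y + 1 / y) = semicircle y" .
qed

text \<open>The mass \<open>1 - 1 / y^2\<close> of the atom is the derivative of its position
  \<open>y + 1 / y\<close>, so averaging the atoms is a change of variables, increasing on each of
  the two intervals.\<close>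

lemma rho34_outer_substitution:
  fixes F :: "real \<Rightarrow> real"
  assumes ab: "a \<le> b" "{a..b} \<subseteq> {1..2} \<or> {a..b} \<subseteq> {-2..-1}"
    and F: "continuous_on UNIV F"
  shows "integrable lborel (\<lambda>y. indicator {a..b} y * (semicircle y * ((1 - 1 / y\<^sup>2) * F (y + 1 / y))))" (is ?I)
    and "(LINT y|lborel. indicator {a..b} y * (semicircle y * ((1 - 1 / y\<^sup>2) * F (y + 1 / y))))
     = (LINT x|lborel. indicator {a + 1 / a..b + 1 / b} x * (rho34 x * F x))" (is ?E)
proof -
  let ?g = "\<lambda>y::real. y + 1 / y"
  \<comment> \<open>The outer formula without case distinction; as \<open>sqrt\<close> is continuous
    on all reals, continuity of \<open>R\<close> is immediate.\<close>
  define R where "R x = sqrt (- 2 * x\<^sup>2 - 2 * \<bar>x\<bar> * sqrt (x\<^sup>2 - 4) + 20) / (4 * pi)" for x :: real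
  have y: "1 \<le> \<bar>y\<bar>" "\<bar>y\<bar> \<le> 2" "y \<noteq> 0" if "y \<in> {a..b}" for y using ab that by auto
  have der: "(?g has_field_derivative (1 - 1 / y\<^sup>2)) (at y within {a..b})" if "y \<in> {a..b}" for y
    using y[OF that] by (auto intro!: derivative_eq_intros simp: power2_eq_square)
  have mono: "?g u \<le> ?g v" if uv: "u \<in> {a..b}" "v \<in> {a..b}" "u \<le> v" for u v
  proof -
    have "1 \<le> u * v"
    proof (cases "{a..b} \<subseteq> {1..2}")
      case True
      with uv have "1 \<le> u" "1 \<le> v" by auto
      thus ?thesis using mult_mono[of 1 u 1 v] by simp
    next
      case False
      with uv ab have "1 \<le> - u" "1 \<le> - v" by auto
      thus ?thesis using mult_mono[of 1 "- u" 1 "- v"] by simp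
    qed
    hence "0 \<le> (v - u) * (1 - 1 / (u * v))" using uv by (intro mult_nonneg_nonneg) auto
    also have "\<dots> = ?g v - ?g u" using y[OF uv(1)] y[OF uv(2)] by (simp add: field_simps)
    finally show ?thesis by simp
  qed
  have im: "?g ` {a..b} \<subseteq> {?g a..?g b}" using ab mono by auto
  have bnd: "2 \<le> \<bar>x\<bar> \<and> \<bar>x\<bar> \<le> 5 / 2" if x: "x \<in> {?g a..?g b}" for x
  proof (cases "{a..b} \<subseteq> {1..2}")
    case True
    hence "0 < ?g a" "0 < ?g b" using ab by (auto intro!: add_pos_pos)
    thus ?thesis using x rho34_joukowski(1,2)[of a] rho34_joukowski(1,2)[of b] y[of a] y[of b] ab by auto
  next
    case False
    hence "?g a < 0" "?g b < 0" using ab by (auto intro!: add_neg_neg)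
    thus ?thesis using x rho34_joukowski(1,2)[of a] rho34_joukowski(1,2)[of b] y[of a] y[of b] ab by auto
  qed
  define f where "f x = R x * F x" for x
  have f_eq: "f x = rho34 x * F x" if "x \<in> {?g a..?g b}" for x
    using bnd[OF that] by (simp add: f_def R_def rho34_outer_eq)
  have f: "continuous_on {?g a..?g b} f"
    unfolding f_def R_def by (intro continuous_intros continuous_on_subset[OF F]) auto
  have f': "set_integrable lborel {?g a..?g b} f"
    by (rule borel_integrable_atLeastAtMost'[OF f])
  have cg: "continuous_on {a..b} ?g" using y by (intro continuous_intros) auto
  define h where "h y = (1 - 1 / y\<^sup>2) * f (?g y)" for y
  have h: "continuous_on {a..b} h"
    unfolding h_def using y
    by (intro continuous_intros continuous_on_compose2[OF f cg im]) auto
  have h': "set_integrable lborel {a..b} h"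
    by (rule borel_integrable_atLeastAtMost'[OF h])
  have h_eq: "indicator {a..b} y *\<^sub>R h y = indicator {a..b} y * (semicircle y * ((1 - 1 / y\<^sup>2) * F (y + 1 / y)))" for y
  proof (cases "y \<in> {a..b}")
    case True
    hence "?g y \<in> {?g a..?g b}" using im by blast
    thus ?thesis using rho34_joukowski(3)[of y] y[OF True] by (simp add: h_def f_eq)
  qed auto
  have f_eq': "indicator {?g a..?g b} x *\<^sub>R f x = indicator {?g a..?g b} x * (rho34 x * F x)" for x
    using f_eq[of x] by (auto simp: indicator_def)
  have "((\<lambda>y. (1 - 1 / y\<^sup>2) *\<^sub>R f (?g y)) has_integral integral {?g a..?g b} f) {a..b}"
    using ab mono im by (intro has_integral_substitution[OF _ _ im f der]) auto
  hence "integral {a..b} h = integral {?g a..?g b} f"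
    by (intro integral_unique) (simp add: h_def[abs_def])
  hence "(LINT y:{a..b}|lborel. h y) = (LINT x:{?g a..?g b}|lborel. f x)"
    using set_borel_integral_eq_integral(2)[OF f'] set_borel_integral_eq_integral(2)[OF h'] by simp
  thus ?E by (simp only: set_lebesgue_integral_def h_eq f_eq')
  show ?I using h' by (simp only: set_integrable_def h_eq)
qed

section \<open>The inner part of the density: the averaged kernels\<close>

text \<open>The two roots of \<open>q^2 - z q + 1\<close> have product 1. If neither lay in the open
  disc, both would lie on the unit circle and be conjugate, making \<open>z\<close> real.\<close>

lemma joukowski_preimage:
  fixes z :: complex
  assumes "0 < Im z"
  obtains q where "norm q < 1" "q \<noteq> 0" "q + 1 / q = z"
proof -
  define r where "r = csqrt (z\<^sup>2 - 4)"
  define p where "p = (z + r) / 2"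
  define m where "m = (z - r) / 2"
  have "r\<^sup>2 = z\<^sup>2 - 4" by (simp add: r_def)
  hence pm: "p * m = 1" "p + m = z" by (simp_all add: p_def m_def field_simps power2_eq_square)
  hence "p \<noteq> 0" "m \<noteq> 0" by auto
  hence inv: "1 / p = m" "1 / m = p" "p \<noteq> 0" "m \<noteq> 0"
    using pm(1) by (simp_all add: divide_eq_eq mult.commute)
  have "norm p < 1 \<or> norm m < 1"
  proof (rule ccontr)
    assume "\<not> ?thesis"
    moreover have "norm p * norm m = 1" using pm(1) by (metis norm_mult norm_one)
    ultimately have "norm p = 1"
      using mult_mono[of 1 "norm m" "norm p" "norm p"] by (simp add: mult.commute)
    hence "p * cnj p = 1" by (simp add: complex_norm_square[symmetric])
    hence "m = cnj p" using inv by (metis mult_cancel_left pm(1))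
    hence "Im z = 0" by (simp add: pm(2)[symmetric])
    thus False using assms by simp
  qed
  thus thesis
  proof
    assume "norm p < 1" thus thesis using that[of p] inv pm by simp
  next
    assume "norm m < 1" thus thesis using that[of m] inv pm by (simp add: add.commute)
  qed
qed

text \<open>
  With \<open>z = (x + i sqrt (4 - x\<^sup>2)) / 2\<close> on the unit circle, \<open>1 - x y + y\<^sup>2 = \<bar>z - y\<bar>\<^sup>2\<close>, so the integral is
  the imaginary part of the semicircle Cauchy transform at \<open>z\<close> up to a factor.  That transform is the
  root \<open>q\<close> of \<open>q + 1 / q = z\<close> in the unit disc, and the nested square roots are those of
  \<open>z - 2 q\<close>, a square root of \<open>z\<^sup>2 - 4\<close>.
\<close>
lemma rho34_inner:
  assumes x: "\<bar>x\<bar> < 2"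
  shows "rho34 x = semicircle x * (LINT y|lborel. semicircle y * (1 / (1 - x * y + y\<^sup>2)))"
proof -
  define s where "s = sqrt (4 - x\<^sup>2)"
  define z where "z = Complex (x / 2) (s / 2)"
  have x2: "x\<^sup>2 < 4" using x abs_square_less_1[of "x / 2"] by (simp add: power_divide)
  hence s: "0 < s" "s\<^sup>2 = 4 - x\<^sup>2" by (simp_all add: s_def)
  obtain q where q: "norm q < 1" "q \<noteq> 0" "q + 1 / q = z"
    using joukowski_preimage[of z] s by (auto simp: z_def)
  have "Im (LINT y|lborel. semicircle y *\<^sub>R (1 / (z - of_real y))) = Im q"
    using LINT_semicircle_cauchy[OF q(1,2)] by (simp add: q(3))
  moreover have "Im (LINT y|lborel. semicircle y *\<^sub>R (1 / (z - of_real y)))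
      = (LINT y|lborel. Im (semicircle y *\<^sub>R (1 / (z - of_real y))))"
    using integrable_semicircle_cauchy[OF q(1,2)] unfolding q(3) by (rule integral_Im[symmetric])
  moreover have "Im (semicircle y *\<^sub>R (1 / (z - of_real y))) = - (s / 2) * (semicircle y * (1 / (1 - x * y + y\<^sup>2)))" for y
  proof -
    have "(Re z - y)\<^sup>2 + (Im z)\<^sup>2 = 1 - x * y + y\<^sup>2"
      using s(2) by (simp add: z_def power2_diff power_divide field_simps)
    thus ?thesis by (simp add: Im_divide z_def)
  qed
  ultimately have Imq: "- (s / 2) * (LINT y|lborel. semicircle y * (1 / (1 - x * y + y\<^sup>2))) = Im q"
    by (simp only: integral_mult_right_zero)
  define r where "r = z - 2 * q"
  have zq: "z * q = q\<^sup>2 + 1" using q(2) by (simp add: q(3)[symmetric] field_simps power2_eq_square)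
  have r2: "r\<^sup>2 = z\<^sup>2 - 4"
  proof -
    have "r\<^sup>2 = z\<^sup>2 - 4 * (z * q) + 4 * q\<^sup>2" by (simp add: r_def power2_eq_square algebra_simps)
    thus ?thesis by (simp add: zq)
  qed
  \<comment> \<open>Positivity of the integral fixes the branch: it gives
    \<open>Im q \<le> 0\<close>, hence \<open>Im r \<ge> 0\<close>, so \<open>2 * Im r\<close> is
    the nonnegative root below.\<close>
  have "0 \<le> LINT y|lborel. semicircle y * (1 / (1 - x * y + y\<^sup>2))"
  proof (rule Bochner_Integration.integral_nonneg)
    fix y
    have "1 - x * y + y\<^sup>2 = (y - x / 2)\<^sup>2 + (s / 2)\<^sup>2"
      using s(2) by (simp add: power2_diff power_divide field_simps)
    thus "0 \<le> semicircle y * (1 / (1 - x * y + y\<^sup>2))" using semicircle_nonneg[of y] by simp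
  qed
  hence "Im q \<le> 0" using s unfolding Imq[symmetric] by (simp add: mult_nonneg_nonneg)
  hence Imr: "0 \<le> Im r" using s by (simp add: r_def z_def)
  have rez: "Re (z\<^sup>2 - 4) = (x\<^sup>2 - 10) / 2" "Im (z\<^sup>2 - 4) = x * s / 2"
    using s(2) by (simp_all add: z_def power2_eq_square field_simps)
  have nrm: "norm (z\<^sup>2 - 4) = sqrt (100 - 16 * x\<^sup>2) / 2"
  proof -
    have "norm (z\<^sup>2 - 4) = sqrt (((x\<^sup>2 - 10) / 2)\<^sup>2 + (x * s / 2)\<^sup>2)" by (simp only: cmod_def rez)
    also have "((x\<^sup>2 - 10) / 2)\<^sup>2 + (x * s / 2)\<^sup>2 = (100 - 16 * x\<^sup>2) / 4"
      unfolding power_divide power_mult_distrib s(2) by (simp add: power2_eq_square field_simps)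
    finally show ?thesis by (simp add: real_sqrt_divide)
  qed
  \<comment> \<open>Recovers the imaginary part of a square root from the norm and real part of its
    square; this is where the nested root arises.\<close>
  have "2 * (Im r)\<^sup>2 = (norm r)\<^sup>2 - Re (r\<^sup>2)"
    by (simp add: cmod_power2) (simp add: power2_eq_square)
  also have "(norm r)\<^sup>2 = norm (z\<^sup>2 - 4)" by (simp only: norm_power[symmetric] r2)
  finally have "(2 * Im r)\<^sup>2 = sqrt (100 - 16 * x\<^sup>2) - x\<^sup>2 + 10"
    unfolding nrm r2 rez by (simp add: power_mult_distrib field_simps)
  hence "2 * Im r = sqrt (sqrt (100 - 16 * x\<^sup>2) - x\<^sup>2 + 10)"
    using Imr by (intro real_sqrt_unique[symmetric]) auto
  moreover have "2 * Im r = s - 4 * Im q" by (simp add: r_def z_def)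
  ultimately have "sqrt (sqrt (100 - 16 * x\<^sup>2) - x\<^sup>2 + 10) - s = - 4 * Im q" by simp
  hence "rho34 x = - 4 * Im q / (4 * pi)" using x by (simp add: rho34_def s_def)
  also have "\<dots> = semicircle x * (LINT y|lborel. semicircle y * (1 / (1 - x * y + y\<^sup>2)))"
    using x unfolding Imq[symmetric] by (simp add: semicircle_eq s_def)
  finally show ?thesis .
qed

lemma AE_abs_neq: "AE y in lborel. \<bar>y\<bar> \<noteq> (c :: real)"
  using AE_lborel_singleton[of c] AE_lborel_singleton[of "- c"] by eventually_elim auto

text \<open>Justifies Fubini. For \<open>k = 0\<close> the integrand is nonnegative and its integral
  over \<open>x\<close> is at most \<open>semicircle y\<close>; for general \<open>k\<close>,
  \<open>chebU k\<close> is bounded on the support of \<open>semicircle x\<close>.\<close>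

lemma integrable_semicircle_semicircle_kesten:
  "integrable (lborel \<Otimes>\<^sub>M lborel) (\<lambda>(y, x). semicircle y * (semicircle x * (chebU k x / (1 - x * y + y\<^sup>2))))"
proof -
  have nn: "0 \<le> semicircle y * (semicircle x * (1 / (1 - x * y + y\<^sup>2)))" for x y
    using semicircle_nonneg[of x] semicircle_nonneg[of y] kesten_denominator_nonneg[of x y] semicircle_eq_0[of x]
    by (cases "\<bar>x\<bar> \<le> 2") auto
  have 0: "integrable (lborel \<Otimes>\<^sub>M lborel) (\<lambda>(y, x). semicircle y * (semicircle x * (1 / (1 - x * y + y\<^sup>2))))"
  proof (rule lborel_pair.Fubini_integrable)
    have "integrable lborel (\<lambda>y. semicircle y)"
      using integrable_semicircle[of "\<lambda>_. 1 :: real"] by simp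
    thus "integrable lborel (\<lambda>y. LINT x|lborel.
        norm (case (y, x) of (y, x) \<Rightarrow> semicircle y * (semicircle x * (1 / (1 - x * y + y\<^sup>2)))))"
    proof (rule Bochner_Integration.integrable_bound)
      show "AE y in lborel. norm (LINT x|lborel.
        norm (case (y, x) of (y, x) \<Rightarrow> semicircle y * (semicircle x * (1 / (1 - x * y + y\<^sup>2))))) \<le> norm (semicircle y)"
        using AE_abs_neq[of 1]
      proof eventually_elim
        case (elim y)
        have "(LINT x|lborel. norm (case (y, x) of (y, x) \<Rightarrow> semicircle y * (semicircle x * (1 / (1 - x * y + y\<^sup>2)))))
            = (LINT x|lborel. semicircle y * (semicircle x * (1 / (1 - x * y + y\<^sup>2))))"
          by (simp only: prod.case real_norm_def abs_of_nonneg[OF nn])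
        also have "\<dots> = semicircle y * (if \<bar>y\<bar> < 1 then 1 else 1 / y\<^sup>2)"
        proof -
          have "(LINT x|lborel. semicircle x * (1 / (1 - x * y + y\<^sup>2))) = (if \<bar>y\<bar> < 1 then 1 else 1 / y\<^sup>2)"
            using LINT_semicircle_kesten[OF elim, of 0] by (simp only: chebU.simps power_0 add_0)
          thus ?thesis by (simp only: integral_mult_right_zero)
        qed
        finally have eq: "(LINT x|lborel. norm (case (y, x) of (y, x) \<Rightarrow> semicircle y * (semicircle x * (1 / (1 - x * y + y\<^sup>2)))))
            = semicircle y * (if \<bar>y\<bar> < 1 then 1 else 1 / y\<^sup>2)" .
        have "1 / y\<^sup>2 \<le> 1" if "\<not> \<bar>y\<bar> < 1"
          using that one_le_power[of "\<bar>y\<bar>" 2] by (simp add: divide_le_eq)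
        hence "semicircle y * (if \<bar>y\<bar> < 1 then 1 else 1 / y\<^sup>2) \<le> semicircle y * 1"
          using semicircle_nonneg[of y] by (intro mult_left_mono) auto
        thus ?case unfolding eq using semicircle_nonneg[of y] by (simp add: abs_mult)
      qed
    qed measurable
    show "AE y in lborel. integrable lborel (\<lambda>x. case (y, x) of (y, x) \<Rightarrow> semicircle y * (semicircle x * (1 / (1 - x * y + y\<^sup>2))))"
      using AE_abs_neq[of 1]
    proof eventually_elim
      case (elim y)
      from integrable_semicircle_kesten[OF elim, of 0]
      have "integrable lborel (\<lambda>x. semicircle x * (1 / (1 - x * y + y\<^sup>2)))"
        by (simp only: chebU.simps)
      thus ?case by (simp only: prod.case integrable_mult_right)
    qed
  qed measurable
  have "bounded (chebU k ` {-2..2})"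
    by (intro compact_imp_bounded compact_continuous_image continuous_intros) auto
  then obtain C where C: "\<forall>z\<in>chebU k ` {-2..2}. norm z \<le> C"
    unfolding bounded_iff by blast
  from 0 have "integrable (lborel \<Otimes>\<^sub>M lborel) (\<lambda>p. C * (case p of (y, x) \<Rightarrow> semicircle y * (semicircle x * (1 / (1 - x * y + y\<^sup>2)))))"
    by simp
  thus ?thesis
  proof (rule Bochner_Integration.integrable_bound)
    show "AE p in lborel \<Otimes>\<^sub>M lborel.
        norm (case p of (y, x) \<Rightarrow> semicircle y * (semicircle x * (chebU k x / (1 - x * y + y\<^sup>2))))
        \<le> norm (C * (case p of (y, x) \<Rightarrow> semicircle y * (semicircle x * (1 / (1 - x * y + y\<^sup>2)))))"
    proof (intro AE_I2, clarsimp simp del: times_divide_eq_right)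
      fix y x :: real
      show "\<bar>semicircle y * (semicircle x * (chebU k x / (1 - x * y + y\<^sup>2)))\<bar>
          \<le> \<bar>C * (semicircle y * (semicircle x * (1 / (1 - x * y + y\<^sup>2))))\<bar>"
      proof (cases "\<bar>x\<bar> \<le> 2")
        case True
        hence "\<bar>chebU k x\<bar> \<le> C" using C by (force simp: abs_le_iff)
        hence "\<bar>chebU k x\<bar> * \<bar>semicircle y * (semicircle x * (1 / (1 - x * y + y\<^sup>2)))\<bar>
            \<le> \<bar>C\<bar> * \<bar>semicircle y * (semicircle x * (1 / (1 - x * y + y\<^sup>2)))\<bar>"
          by (intro mult_right_mono) auto
        thus ?thesis by (simp add: abs_mult mult_ac)
      qed (simp add: semicircle_eq_0)
    qed
  qed measurable
qed

text \<open>The double integral is taken in both orders: over \<open>y\<close> first it gives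
  \<open>rho34_inner\<close>, over \<open>x\<close> first the kernel integral.\<close>

lemma LINT_rho34_inner_eq:
  "(LINT x|lborel. indicator {-2<..<2} x * (rho34 x * chebU k x))
     = (LINT y|lborel. semicircle y * (if \<bar>y\<bar> < 1 then y ^ k else 1 / y ^ (k + 2)))"
proof -
  let ?K = "\<lambda>y x. semicircle y * (semicircle x * (chebU k x / (1 - x * y + y\<^sup>2)))"
  have "(LINT y|lborel. ?K y x) = indicator {-2<..<2} x * (rho34 x * chebU k x)" for x
  proof (cases "\<bar>x\<bar> < 2")
    case True
    have "?K y x = semicircle x * chebU k x * (semicircle y * (1 / (1 - x * y + y\<^sup>2)))" for y by simp
    hence "(LINT y|lborel. ?K y x) = semicircle x * chebU k x * (LINT y|lborel. semicircle y * (1 / (1 - x * y + y\<^sup>2)))"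
      by (simp only: integral_mult_right_zero)
    thus ?thesis using rho34_inner[OF True] True by (auto simp: indicator_def abs_less_iff)
  next
    case False
    hence "x \<notin> {-2<..<2}" by auto
    thus ?thesis using semicircle_eq_0[of x] False by simp
  qed
  moreover have "(LINT y|lborel. (LINT x|lborel. ?K y x))
     = (LINT y|lborel. semicircle y * (if \<bar>y\<bar> < 1 then y ^ k else 1 / y ^ (k + 2)))"
  proof (rule integral_cong_AE)
    show "AE y in lborel. (LINT x|lborel. ?K y x) = semicircle y * (if \<bar>y\<bar> < 1 then y ^ k else 1 / y ^ (k + 2))"
      using AE_abs_neq[of 1]
    proof eventually_elim
      case (elim y)
      show ?case unfolding LINT_semicircle_kesten[OF elim, symmetric] by (rule integral_mult_right_zero)
    qed
  qed measurable
  ultimately show ?thesis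
    using lborel_pair.Fubini_integral[OF integrable_semicircle_semicircle_kesten, of k] by simp
qed

text \<open>For \<open>abs y > 1\<close> the kernel integrates \<open>chebU k\<close> only to
  \<open>1 / y ^ (k + 2)\<close>; the deficit from \<open>y ^ k\<close> is the contribution of the
  atom, which is carried by the outer part of \<open>rho34\<close>.\<close>

lemma LINT_rho34_chebU: "(LINT x|lborel. rho34 x * chebU k x) = semicircle_moment k 0"
proof -
  \<comment> \<open>\<open>B\<close> collects the atoms in the variable \<open>y\<close>,
    \<open>E\<close> the pieces of \<open>rho34\<close> in the variable \<open>x\<close>.\<close>
  define B where "B a b y = indicator {a..b} y * (semicircle y * ((1 - 1 / y\<^sup>2) * chebU k (y + 1 / y)))" for a b y :: real
  define E where "E a b x = indicator {a..b} x * (rho34 x * chebU k x)" for a b x :: real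
  have cheb: "continuous_on UNIV (chebU k)" by (intro continuous_intros)
  have B: "integrable lborel (B 1 2)" "integrable lborel (B (-2) (-1))"
    unfolding B_def by (rule rho34_outer_substitution(1)[OF _ _ cheb]; simp)+
  have BE: "(LINT y|lborel. B 1 2 y) = (LINT x|lborel. E 2 (5/2) x)"
      "(LINT y|lborel. B (-2) (-1) y) = (LINT x|lborel. E (-5/2) (-2) x)"
    unfolding B_def E_def
    using rho34_outer_substitution(2)[OF _ _ cheb, of 1 2]
      rho34_outer_substitution(2)[OF _ _ cheb, of "-2" "-1"] by simp_all
  have rho: "integrable lborel (\<lambda>x. rho34 x * chebU k x)"
    by (rule integrable_rho34[OF cheb])
  have E: "integrable lborel (E a b)" for a b
    unfolding E_def using integrable_mult_indicator[OF _ rho, of "{a..b}"] by simp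
  have semicircle: "integrable lborel (\<lambda>y. semicircle y * y ^ k)"
    using integrable_semicircle_moment[of k 0] by simp
  have [measurable]: "B a b \<in> borel_measurable borel" "E a b \<in> borel_measurable borel" for a b
    unfolding B_def E_def by measurable
  have "(LINT x|lborel. indicator {-2<..<2} x * (rho34 x * chebU k x))
      = (LINT x|lborel. rho34 x * chebU k x - E 2 (5/2) x - E (-5/2) (-2) x)"
  proof (rule integral_cong_AE)
    show "AE x in lborel. indicator {-2<..<2} x * (rho34 x * chebU k x)
        = rho34 x * chebU k x - E 2 (5/2) x - E (-5/2) (-2) x"
      using AE_abs_neq[of 2]
    proof eventually_elim
      case (elim x)
      thus ?case using rho34_eq_0[of x] by (auto simp: E_def indicator_def abs_if split: if_splits)
    qed
  qed measurable
  also have "\<dots> = (LINT x|lborel. rho34 x * chebU k x) - (LINT x|lborel. E 2 (5/2) x) - (LINT x|lborel. E (-5/2) (-2) x)"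
    using rho E by (simp add: Bochner_Integration.integral_diff)
  finally have 1: "(LINT x|lborel. indicator {-2<..<2} x * (rho34 x * chebU k x)) = \<dots>" .
  have "(LINT y|lborel. semicircle y * (if \<bar>y\<bar> < 1 then y ^ k else 1 / y ^ (k + 2)))
      = (LINT y|lborel. semicircle y * y ^ k - B 1 2 y - B (-2) (-1) y)"
  proof (rule integral_cong_AE)
    show "AE y in lborel. semicircle y * (if \<bar>y\<bar> < 1 then y ^ k else 1 / y ^ (k + 2))
        = semicircle y * y ^ k - B 1 2 y - B (-2) (-1) y"
      using AE_abs_neq[of 1]
    proof eventually_elim
      case (elim y)
      consider "\<bar>y\<bar> < 1" | "1 < \<bar>y\<bar>" "\<bar>y\<bar> \<le> 2" | "2 < \<bar>y\<bar>" using elim by linarith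
      thus ?case
      proof cases
        case 1
        thus ?thesis by (auto simp: B_def indicator_def)
      next
        case 2
        hence "y \<noteq> 0" by auto
        have "(1 - 1 / y\<^sup>2) * chebU k (y + 1 / y) = 1 / y * ((y - 1 / y) * chebU k (y + 1 / y))"
          using \<open>y \<noteq> 0\<close> by (simp add: field_simps power2_eq_square)
        also have "\<dots> = y ^ k - 1 / y ^ (k + 2)"
          unfolding chebU_joukowski[OF \<open>y \<noteq> 0\<close>] using \<open>y \<noteq> 0\<close> by (simp add: field_simps)
        finally have *: "(1 - 1 / y\<^sup>2) * chebU k (y + 1 / y) = y ^ k - 1 / y ^ (k + 2)" .
        have "B 1 2 y + B (-2) (-1) y = semicircle y * (y ^ k - 1 / y ^ (k + 2))"
          unfolding B_def * using 2 by (auto simp: indicator_def abs_if split: if_splits)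
        thus ?thesis using 2 by (simp add: algebra_simps)
      next
        case 3
        thus ?thesis by (simp add: B_def semicircle_eq_0)
      qed
    qed
  qed measurable
  also have "\<dots> = (LINT y|lborel. semicircle y * y ^ k) - (LINT y|lborel. B 1 2 y) - (LINT y|lborel. B (-2) (-1) y)"
    using semicircle B by (simp add: Bochner_Integration.integral_diff)
  finally have 2: "(LINT y|lborel. semicircle y * (if \<bar>y\<bar> < 1 then y ^ k else 1 / y ^ (k + 2))) = \<dots>" .
  show ?thesis
    using LINT_rho34_inner_eq[of k] unfolding 1 2 BE by (simp add: semicircle_moment_def)
qed

theorem theorem3p4:
  shows "(\<forall>x. 0 \<le> rho34 x) \<and> rho34 \<in> borel_measurable borel \<and>
         is_distribution_with_moments (density lborel (\<lambda>x. ennreal (rho34 x))) G12_moment"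
proof (intro conjI allI)
  let ?M = "density lborel (\<lambda>x. ennreal (rho34 x))"
  have int: "integrable lborel (\<lambda>x. rho34 x * (x ^ n * chebU k x))" for n k
    by (intro integrable_rho34 continuous_intros)
  have "G12 = (\<lambda>v w. wm_pos 1 v w + wm_pos 2 v w)"
    by (simp add: G12_def fun_eq_iff)
  \<comment> \<open>The case \<open>k = 0\<close>: the polynomial is constant and
    \<open>comb_vec 0\<close> is the vacuum.\<close>
  hence moment: "(LINT x|lborel. rho34 x * x ^ n) = G12_moment n" for n
    using moments_from_chebU[OF int LINT_rho34_chebU, of n 0]
    by (simp add: G12_moment_def wm_vacuum_state_def comb_vec_0)
  have "emeasure ?M (space ?M) = ennreal (LINT x|lborel. rho34 x)"
    using int[of 0 0] by (simp add: emeasure_density nn_integral_eq_integral rho34_nonneg)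
  also have "(LINT x|lborel. rho34 x) = 1"
    using LINT_rho34_chebU[of 0] by (simp add: semicircle_moment_0)
  finally have "prob_space ?M" by (intro prob_spaceI) simp
  moreover have "integrable ?M (\<lambda>x. x ^ n)" for n
    using int[of n 0] by (subst integrable_density) (auto simp: rho34_nonneg)
  moreover have "(LINT x|?M. x ^ n) = G12_moment n" for n
    unfolding moment[symmetric] by (subst integral_density) (auto simp: rho34_nonneg)
  ultimately show "is_distribution_with_moments ?M G12_moment"
    by (simp add: is_distribution_with_moments_def)
qed (simp_all add: rho34_nonneg)

end
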